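(* Let $X$ be a Banach space with a Schauder basis $\{x_n\}$ and let $P$ be the positive cone of $\{x_n\}$. If $\{x_n\}$ is shrinking and boundedly complete on $P$, then $P$ is reflexive.
   Context: All spaces are real. $B_X$ is the closed unit ball of $X$. The positive cone of a Schauder basis $\{x_n\}$ is $P=\{\sum_{i=1}^\infty\lambda_i x_i : \lambda_i\ge 0\text{ for each } i\}$ (series convergent in $X$). $P$ is reflexive if $P\cap B_X$ is weakly compact. $\{x_n\}$ is boundedly complete on $P$ if for each sequence $\{a_n\}$ of nonnegative real numbers, $\sup_{n\in\mathbb{N}}\|\sum_{i=1}^n a_i x_i\|<+\infty$ implies that $\sum_{i=1}^\infty a_i x_i$ converges in $X$, so that $\sum_{i=1}^\infty a_i x_i\in P$. $\{x_n\}$ is shrinking if the sequence $\{x_n^*\}$ of its coefficient functionals is a Schauder basis of $X^*$. *)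

theory Defs
  imports "HOL-Analysis.Analysis"
begin

definition schauder_basis :: "(nat \<Rightarrow> 'a::banach) \<Rightarrow> bool" where
  "schauder_basis b \<longleftrightarrow> (\<forall>x. \<exists>!a::nat \<Rightarrow> real. (\<lambda>n. a n *\<^sub>R b n) sums x)"

definition basis_coeff :: "(nat \<Rightarrow> 'a::banach) \<Rightarrow> nat \<Rightarrow> 'a \<Rightarrow> real" where
  "basis_coeff b n x = (THE a::nat \<Rightarrow> real. (\<lambda>k. a k *\<^sub>R b k) sums x) n"

definition positive_cone :: "(nat \<Rightarrow> 'a::banach) \<Rightarrow> 'a set" where
  "positive_cone b = {x. \<exists>a::nat \<Rightarrow> real. (\<forall>n. 0 \<le> a n) \<and> (\<lambda>n. a n *\<^sub>R b n) sums x}"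

text \<open>The coarsest topology making all continuous linear functionals continuous: \<open>euclidean\<close> on
  the function type is the topology of pointwise convergence.\<close>

definition weak_topology :: "'a::real_normed_vector topology" where
  "weak_topology =
     pullback_topology UNIV (\<lambda>x (f :: 'a \<Rightarrow>\<^sub>L real). blinfun_apply f x) euclidean"

definition reflexive_cone :: "'a::banach set \<Rightarrow> bool" where
  "reflexive_cone P \<longleftrightarrow> compactin weak_topology (P \<inter> cball 0 1)"

definition boundedly_complete_on_cone :: "(nat \<Rightarrow> 'a::banach) \<Rightarrow> bool" where
  "boundedly_complete_on_cone b \<longleftrightarrow>
     (\<forall>a::nat \<Rightarrow> real. (\<forall>n. 0 \<le> a n) \<longrightarrow>
        bdd_above (range (\<lambda>n. norm (\<Sum>i\<le>n. a i *\<^sub>R b i))) \<longrightarrow>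
        summable (\<lambda>i. a i *\<^sub>R b i))"

text \<open>\<open>'a \<Rightarrow>\<^sub>L real\<close> is the dual space with the operator norm, and \<open>f\<close> is the sequence of
  coefficient functionals viewed in it. For a Schauder basis of a Banach space these functionals
  are automatically bounded (Banach), so such an \<open>f\<close> always exists, and it is unique.\<close>

definition shrinking_basis :: "(nat \<Rightarrow> 'a::banach) \<Rightarrow> bool" where
  "shrinking_basis b \<longleftrightarrow>
     (\<exists>f :: nat \<Rightarrow> ('a \<Rightarrow>\<^sub>L real).
        (\<forall>n x. blinfun_apply (f n) x = basis_coeff b n x) \<and> schauder_basis f)"

end

theory Submission
  imports Defs
begin

text \<open>Write \<open>f\<close> for the coefficient functionals of the basis \<open>b\<close>. Weak compactness of a set \<open>S\<close> is
  compactness of its image in the space of all real functions on the dual, with the topology of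
  pointwise convergence, under \<open>x \<mapsto> (g \<mapsto> g x)\<close>. The key point is that for the positive part \<open>S\<close> of
  the unit ball this image can be described intrinsically: it consists of all elements \<open>\<phi>\<close>
  of the unit ball of the bidual with \<open>0 \<le> \<phi> (f n)\<close> for every \<open>n\<close> (\<open>evaluation_image_cone_ball\<close>).
  Such \<open>\<phi>\<close> are cut out by conditions that are closed for pointwise convergence, inside a product of
  compact intervals, so Tychonoff's theorem makes the image compact
  (\<open>compact_positive_bidual_ball\<close>).

  The description of the image is where the hypotheses on the basis enter. Given \<open>\<phi>\<close>, the candidate
  preimage is the sum of the series \<open>\<Sum>n. \<phi> (f n) *\<^sub>R b n\<close>, whose coefficients are nonnegative. As \<open>b\<close>
  is shrinking, every functional \<open>g\<close> is the norm limit of its expansion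
  \<open>\<Sum>n. g (b n) *\<^sub>R f n\<close>; applying \<open>\<phi>\<close> shows that \<open>g\<close> maps the partial sums of the candidate series
  to a sequence converging to \<open>\<phi> g\<close> (\<open>bidual_apply_sums\<close>). The partial sums are therefore weakly
  bounded, hence norm bounded (\<open>weakly_bounded_imp_bounded\<close>), and bounded completeness on the cone
  makes the series converge to some \<open>x\<close>. Then \<open>g x = \<phi> g\<close> for all \<open>g\<close>, and a norming functional
  (\<open>exists_norming_functional\<close>) gives \<open>norm x \<le> 1\<close>.

  The two general tools are the Hahn-Banach theorem, in the form of norming functionals, and the
  uniform boundedness principle.\<close>

section \<open>Norming functionals\<close>

text \<open>Requiring only an inequality for the scaling is enough: equality follows from the inequality for
  the inverse factor, see \<open>sublinear_scaleR\<close>. The weaker form is easier to verify for infima.\<close>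

definition sublinear :: "('a::real_vector \<Rightarrow> real) \<Rightarrow> bool" where
  "sublinear p \<longleftrightarrow> (\<forall>x y. p (x + y) \<le> p x + p y) \<and> (\<forall>c\<ge>0. \<forall>x. p (c *\<^sub>R x) \<le> c * p x)"

lemma sublinear_add: "sublinear p \<Longrightarrow> p (x + y) \<le> p x + p y"
  by (simp add: sublinear_def)

lemma sublinear_scaleR_le: "sublinear p \<Longrightarrow> 0 \<le> c \<Longrightarrow> p (c *\<^sub>R x) \<le> c * p x"
  by (simp add: sublinear_def)

lemma sublinear_zero:
  assumes "sublinear p"
  shows "p 0 = 0"
  using sublinear_scaleR_le[OF assms, of 0 0] sublinear_add[OF assms, of 0 0] by simp

lemma sublinear_scaleR:
  assumes "sublinear p" "0 \<le> c"
  shows "p (c *\<^sub>R x) = c * p x"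
proof (cases "c = 0")
  case True
  then show ?thesis using sublinear_zero[OF assms(1)] by simp
next
  case False
  with assms(2) have "c > 0" by simp
  have "p x = p (inverse c *\<^sub>R c *\<^sub>R x)" using \<open>c > 0\<close> by simp
  also have "\<dots> \<le> inverse c * p (c *\<^sub>R x)"
    using sublinear_scaleR_le[OF assms(1)] \<open>c > 0\<close> by (metis inverse_nonnegative_iff_nonnegative less_imp_le)
  finally have "c * p x \<le> p (c *\<^sub>R x)" using \<open>c > 0\<close> by (simp add: field_simps)
  then show ?thesis using sublinear_scaleR_le[OF assms] by (metis order_antisym)
qed

lemma sublinear_minus_le:
  assumes "sublinear p"
  shows "- p (- x) \<le> p x"
  using sublinear_add[OF assms, of x "- x"] sublinear_zero[OF assms] by simp

text \<open>For sublinear \<open>p\<close> this is the largest sublinear functional below \<open>p\<close> whose value at \<open>- y\<close> is at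
  most \<open>- p y\<close>; it is linear on the line through \<open>y\<close>. This one construction is used
  twice: minimal sublinear functionals cannot be tilted any further, which makes them linear, and
  tilting the norm along \<open>x\<close> before passing to a minimal functional makes the result attain
  \<open>norm x\<close> at \<open>x\<close>.\<close>

definition tilt :: "('a::real_vector \<Rightarrow> real) \<Rightarrow> 'a \<Rightarrow> 'a \<Rightarrow> real" where
  "tilt p y x = (INF t\<in>{0..}. p (x + t *\<^sub>R y) - t * p y)"

lemma tilt_le:
  assumes "sublinear p" "0 \<le> t"
  shows "tilt p y x \<le> p (x + t *\<^sub>R y) - t * p y"
  unfolding tilt_def
proof (rule cINF_lower)
  have "- p (- x) \<le> p (x + s *\<^sub>R y) - s * p y" if "0 \<le> s" for s
    using sublinear_add[OF assms(1), of "x + s *\<^sub>R y" "- x"] sublinear_scaleR[OF assms(1) that, of y]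
    by simp
  then show "bdd_below ((\<lambda>t. p (x + t *\<^sub>R y) - t * p y) ` {0..})"
    by (intro bdd_belowI2[where m = "- p (- x)"]) auto
qed (use assms(2) in auto)

lemma tilt_greatest:
  assumes "\<And>t. 0 \<le> t \<Longrightarrow> m \<le> p (x + t *\<^sub>R y) - t * p y"
  shows "m \<le> tilt p y x"
  unfolding tilt_def by (rule cINF_greatest) (use assms in auto)

lemma tilt_le_self: "sublinear p \<Longrightarrow> tilt p y x \<le> p x"
  using tilt_le[of p 0 y x] by simp

lemma tilt_minus_le: "sublinear p \<Longrightarrow> tilt p y (- y) \<le> - p y"
  using tilt_le[of p 1 y "- y"] by (simp add: sublinear_zero)

lemma sublinear_tilt:
  assumes "sublinear p"
  shows "sublinear (tilt p y)"
  unfolding sublinear_def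
proof (intro conjI allI impI)
  fix x z
  have "tilt p y (x + z) - (p (x + t *\<^sub>R y) - t * p y) \<le> p (z + s *\<^sub>R y) - s * p y"
    if "0 \<le> t" "0 \<le> s" for t s
    using tilt_le[OF assms, of "t + s" y "x + z"] that
      sublinear_add[OF assms, of "x + t *\<^sub>R y" "z + s *\<^sub>R y"]
    by (simp add: algebra_simps)
  then have "tilt p y (x + z) - (p (x + t *\<^sub>R y) - t * p y) \<le> tilt p y z" if "0 \<le> t" for t
    using that by (intro tilt_greatest) auto
  then have "tilt p y (x + z) - tilt p y z \<le> tilt p y x"
    by (intro tilt_greatest) (simp add: algebra_simps)
  then show "tilt p y (x + z) \<le> tilt p y x + tilt p y z" by simp
next
  fix c :: real and x
  assume "0 \<le> c"
  show "tilt p y (c *\<^sub>R x) \<le> c * tilt p y x"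
  proof (cases "c = 0")
    case True
    then show ?thesis using tilt_le_self[OF assms, of y 0] sublinear_zero[OF assms] by simp
  next
    case False
    with \<open>0 \<le> c\<close> have "c > 0" by simp
    have "tilt p y (c *\<^sub>R x) / c \<le> p (x + t *\<^sub>R y) - t * p y" if "0 \<le> t" for t
    proof -
      have "tilt p y (c *\<^sub>R x) \<le> p (c *\<^sub>R (x + t *\<^sub>R y)) - c * t * p y"
        using tilt_le[OF assms, of "c * t" y "c *\<^sub>R x"] that \<open>0 \<le> c\<close> by (simp add: scaleR_add_right)
      also have "\<dots> = c * (p (x + t *\<^sub>R y) - t * p y)"
        by (simp add: sublinear_scaleR[OF assms \<open>0 \<le> c\<close>] right_diff_distrib)
      finally show ?thesis using \<open>c > 0\<close> by (simp add: divide_le_eq mult.commute)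
    qed
    then have "tilt p y (c *\<^sub>R x) / c \<le> tilt p y x" by (rule tilt_greatest)
    then show ?thesis using \<open>c > 0\<close> by (simp add: divide_le_eq mult.commute)
  qed
qed

text \<open>Subadditivity of the infimum needs the chain condition: two members that are nearly optimal at
  \<open>x\<close> and at \<open>y\<close> are replaced by the smaller of the two, which is subadditive.\<close>

lemma sublinear_INF_chain:
  assumes "C \<noteq> {}" "\<And>p. p \<in> C \<Longrightarrow> sublinear p"
    and chain: "\<And>p q. p \<in> C \<Longrightarrow> q \<in> C \<Longrightarrow> p \<le> q \<or> q \<le> p"
    and bdd: "\<And>x. bdd_below ((\<lambda>p. p x) ` C)"
  shows "sublinear (\<lambda>x. INF p\<in>C. p x)"
proof -
  let ?m = "\<lambda>x. INF p\<in>C. p x"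
  have lower: "?m x \<le> p x" if "p \<in> C" for p x
    using that by (intro cINF_lower bdd)
  show ?thesis
    unfolding sublinear_def
  proof (intro conjI allI impI)
    fix x y
    have "?m (x + y) - p x \<le> q y" if pq: "p \<in> C" "q \<in> C" for p q
    proof -
      obtain r where r: "r \<in> C" "r \<le> p" "r \<le> q"
        using chain[OF pq] pq by (metis order_refl)
      have "?m (x + y) \<le> r (x + y)" using r by (intro lower)
      also have "\<dots> \<le> r x + r y" using assms(2) r by (intro sublinear_add)
      also have "\<dots> \<le> p x + q y" using r by (intro add_mono) (auto simp: le_fun_def)
      finally show ?thesis by simp
    qed
    then have "?m (x + y) - p x \<le> ?m y" if "p \<in> C" for p
      using that assms(1) by (intro cINF_greatest) auto
    then have "?m (x + y) - ?m y \<le> ?m x"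
      using assms(1) by (intro cINF_greatest) (auto simp: algebra_simps)
    then show "?m (x + y) \<le> ?m x + ?m y" by simp
  next
    fix c :: real and x
    assume "0 \<le> c"
    have le: "?m (c *\<^sub>R x) \<le> c * p x" if "p \<in> C" for p
      using lower[OF that] sublinear_scaleR_le[OF assms(2)[OF that] \<open>0 \<le> c\<close>] by (meson order_trans)
    show "?m (c *\<^sub>R x) \<le> c * ?m x"
    proof (cases "c = 0")
      case True
      then show ?thesis using le assms(1) by auto
    next
      case False
      with \<open>0 \<le> c\<close> have "c > 0" by simp
      have "?m (c *\<^sub>R x) / c \<le> ?m x"
        using assms(1) le \<open>c > 0\<close> by (intro cINF_greatest) (auto simp: divide_le_eq mult.commute)
      then show ?thesis using \<open>c > 0\<close> by (simp add: divide_le_eq mult.commute)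
    qed
  qed
qed

text \<open>Zorn's lemma applies to the sublinear functionals below \<open>p0\<close> because each of them satisfies
  \<open>- p0 (- x) \<le> p x\<close>, so that the infimum of a chain is finite.\<close>

lemma exists_minimal_sublinear:
  assumes "sublinear p0"
  obtains m where "sublinear m" "m \<le> p0" "\<And>q. sublinear q \<Longrightarrow> q \<le> m \<Longrightarrow> q = m"
proof -
  define A where "A = {p. sublinear p \<and> p \<le> p0}"
  define R where "R = relation_of (\<lambda>p q. q \<le> p) A"
  have "partial_order_on A R"
    unfolding R_def by (intro partial_order_on_relation_ofI) auto
  moreover have "\<exists>u\<in>A. \<forall>a\<in>C. u \<le> a" if "C \<in> Chains R" for C
  proof (cases "C = {}")
    case True
    then show ?thesis using assms by (auto simp: A_def)
  next
    case False
    have CA: "p \<in> A" if "p \<in> C" for p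
      using that \<open>C \<in> Chains R\<close> by (auto simp: Chains_def R_def relation_of_def)
    have chain: "p \<le> q \<or> q \<le> p" if "p \<in> C" "q \<in> C" for p q
      using that \<open>C \<in> Chains R\<close> by (auto simp: Chains_def R_def relation_of_def)
    have bdd: "bdd_below ((\<lambda>p. p x) ` C)" for x
    proof (rule bdd_belowI2)
      fix p assume "p \<in> C"
      then have "sublinear p" "p (- x) \<le> p0 (- x)" using CA by (auto simp: A_def le_fun_def)
      then show "- p0 (- x) \<le> p x" using sublinear_minus_le[of p x] by simp
    qed
    let ?m = "\<lambda>x. INF p\<in>C. p x"
    have "?m \<le> p" if "p \<in> C" for p
      using that by (auto simp: le_fun_def intro!: cINF_lower bdd)
    moreover from this have "?m \<le> p0"
      using False CA by (auto simp: A_def intro: order_trans)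
    moreover have "sublinear ?m"
      using CA chain bdd False by (intro sublinear_INF_chain) (auto simp: A_def)
    ultimately show ?thesis by (intro bexI[of _ ?m]) (auto simp: A_def)
  qed
  ultimately obtain m where "m \<in> A" "\<forall>a\<in>A. a \<le> m \<longrightarrow> a = m"
    unfolding R_def using predicate_Zorn[of A "\<lambda>p q. q \<le> p"] by blast
  then show ?thesis using that[of m] by (auto simp: A_def intro: order_trans)
qed

text \<open>By minimality each tilt of \<open>m\<close> equals \<open>m\<close>. Since tilting along \<open>y\<close> brings the value at \<open>- y\<close> down
  to \<open>- m y\<close>, this makes \<open>m\<close> odd, and an odd subadditive function is also
  superadditive.\<close>

lemma minimal_sublinear_linear:
  assumes m: "sublinear m" and min: "\<And>q. sublinear q \<Longrightarrow> q \<le> m \<Longrightarrow> q = m"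
  shows "linear m"
proof -
  have minus: "m (- y) = - m y" for y
  proof -
    have "tilt m y = m"
      by (intro min sublinear_tilt m) (simp add: le_fun_def tilt_le_self m)
    then show ?thesis
      using tilt_minus_le[OF m, of y] sublinear_minus_le[OF m, of y] by simp
  qed
  show ?thesis
  proof (rule linearI)
    fix x y
    show "m (x + y) = m x + m y"
      using sublinear_add[OF m, of x y] sublinear_add[OF m, of "- x" "- y"] minus[of "x + y"]
      by (simp add: minus)
  next
    fix c :: real and x
    show "m (c *\<^sub>R x) = c *\<^sub>R m x"
    proof (cases "0 \<le> c")
      case True
      then show ?thesis by (simp add: sublinear_scaleR m)
    next
      case False
      then have "m ((- c) *\<^sub>R x) = - c * m x" by (intro sublinear_scaleR m) simp
      then show ?thesis using minus[of "c *\<^sub>R x"] by simp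
    qed
  qed
qed

text \<open>This is the consequence of the Hahn-Banach theorem needed below. A minimal sublinear functional
  below the norm tilted along \<open>x\<close> is linear, dominated by the norm, and at most \<open>- norm x\<close> at \<open>- x\<close>.\<close>

lemma exists_norming_functional:
  fixes x :: "'a::real_normed_vector"
  obtains g :: "'a \<Rightarrow>\<^sub>L real" where "norm g \<le> 1" "blinfun_apply g x = norm x"
proof -
  have norm: "sublinear (norm :: 'a \<Rightarrow> real)"
    by (simp add: sublinear_def norm_triangle_ineq)
  obtain m where m: "sublinear m" "m \<le> tilt norm x"
    and min: "\<And>q. sublinear q \<Longrightarrow> q \<le> m \<Longrightarrow> q = m"
    using exists_minimal_sublinear[OF sublinear_tilt[OF norm]] by metis
  have lin: "linear m" using m(1) min by (rule minimal_sublinear_linear)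
  have le: "m z \<le> norm z" for z
    using m(2) tilt_le_self[OF norm, of x z] by (meson le_fun_def order_trans)
  have abs: "norm (m z) \<le> norm z" for z
    using le[of z] le[of "- z"] linear_neg[OF lin, of z] by simp
  have bl: "bounded_linear m"
    using lin abs by (intro bounded_linear_intro[where K = 1]) (auto simp: linear_add linear_scale)
  have "m (- x) \<le> - norm x"
    using m(2) tilt_minus_le[OF norm, of x] by (meson le_fun_def order_trans)
  then have "m x = norm x" using le[of x] linear_neg[OF lin, of x] by simp
  moreover have "norm (Blinfun m) \<le> 1"
    using abs by (intro norm_blinfun_bound) (auto simp: bounded_linear_Blinfun_apply bl)
  ultimately show ?thesis
    using that[of "Blinfun m"] by (simp add: bounded_linear_Blinfun_apply bl)
qed

section \<open>Uniform boundedness\<close>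

text \<open>The sets where the whole family is bounded by \<open>n\<close> are closed and cover the space, so by Baire's
  theorem one of them contains a ball; differences of points of that ball give the bound on the
  operator norms.\<close>

lemma uniform_boundedness:
  fixes F :: "('a::banach \<Rightarrow>\<^sub>L 'b::real_normed_vector) set"
  assumes "\<And>x. bounded ((\<lambda>T. blinfun_apply T x) ` F)"
  shows "bounded F"
proof -
  define A where "A n = {x. \<forall>T\<in>F. norm (blinfun_apply T x) \<le> real n}" for n
  have closed: "closed (A n)" for n
    unfolding A_def Ball_def
    by (intro closed_Collect_all closed_Collect_imp open_Collect_const closed_Collect_le continuous_intros)
  have cover: "(\<Union>n. A n) = UNIV"
  proof -
    have "\<exists>n. x \<in> A n" for x
    proof -
      obtain B where "\<forall>T\<in>F. norm (blinfun_apply T x) \<le> B"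
        using assms[of x] by (auto simp: bounded_iff)
      then show ?thesis unfolding A_def using real_arch_simple[of B] by (auto intro: order_trans)
    qed
    then show ?thesis by auto
  qed
  have "\<exists>n. interior (A n) \<noteq> {}"
  proof (rule ccontr)
    assume "\<not> ?thesis"
    then have "euclidean interior_of \<Union>(range A) = {}"
      using closed by (intro Baire_category_alt) (auto simp: completely_metrizable_space_euclidean)
    then show False using cover by simp
  qed
  then obtain n x0 where "x0 \<in> interior (A n)" by blast
  then obtain r where "r > 0" and r: "cball x0 r \<subseteq> A n"
    by (meson mem_interior_cball)
  have "norm T \<le> 2 * real n / r" if "T \<in> F" for T
  proof (rule norm_blinfun_bound)
    fix x
    show "norm (blinfun_apply T x) \<le> 2 * real n / r * norm x"
    proof (cases "x = 0")
      case False
      \<comment> \<open>Scaled so that \<open>x0 + ?y\<close> has distance exactly \<open>r\<close> from \<open>x0\<close> and so still lies in \<open>A n\<close>.\<close>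
      let ?y = "(r / norm x) *\<^sub>R x"
      have "x0 \<in> A n" "x0 + ?y \<in> A n"
        using r \<open>r > 0\<close> False by (auto simp: subset_iff dist_norm)
      then have "norm (blinfun_apply T x0) \<le> n" "norm (blinfun_apply T (x0 + ?y)) \<le> n"
        using that by (auto simp: A_def)
      then have "norm (blinfun_apply T ?y) \<le> 2 * n"
        using norm_triangle_ineq4[of "blinfun_apply T (x0 + ?y)" "blinfun_apply T x0"]
        by (simp add: blinfun.add_right)
      then show ?thesis
        using \<open>r > 0\<close> False by (simp add: blinfun.scaleR_right field_simps)
    qed simp
  qed (use \<open>r > 0\<close> in simp)
  then show ?thesis by (auto simp: bounded_iff)
qed

text \<open>The uniform boundedness principle is applied on the dual, which is complete even if the space is
  not, to the evaluations at the points of \<open>S\<close>; norming functionals show that passing from a point to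
  its evaluation does not decrease the norm.\<close>

lemma weakly_bounded_imp_bounded:
  fixes S :: "'a::real_normed_vector set"
  assumes "\<And>g :: 'a \<Rightarrow>\<^sub>L real. bounded (blinfun_apply g ` S)"
  shows "bounded S"
proof -
  define ev :: "'a \<Rightarrow> ('a \<Rightarrow>\<^sub>L real) \<Rightarrow>\<^sub>L real" where "ev x = Blinfun (\<lambda>g. blinfun_apply g x)" for x
  have ev: "blinfun_apply (ev x) g = blinfun_apply g x" for x g
    unfolding ev_def by (simp add: bounded_linear_Blinfun_apply blinfun.bounded_linear_left)
  have "bounded (ev ` S)"
    using assms by (intro uniform_boundedness) (simp add: image_image ev)
  then obtain B where B: "\<And>x. x \<in> S \<Longrightarrow> norm (ev x) \<le> B" by (auto simp: bounded_iff)
  have "norm x \<le> B" if "x \<in> S" for x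
  proof -
    obtain g :: "'a \<Rightarrow>\<^sub>L real" where g: "norm g \<le> 1" "blinfun_apply g x = norm x"
      by (rule exists_norming_functional)
    have "norm x = norm (blinfun_apply (ev x) g)" by (simp add: ev g)
    also have "\<dots> \<le> norm (ev x) * norm g" by (rule norm_blinfun)
    also have "\<dots> \<le> norm (ev x)" using g(1) by (simp add: mult_left_le)
    finally show ?thesis using B[OF that] by simp
  qed
  then show ?thesis by (auto simp: bounded_iff)
qed

section \<open>Weak compactness through the bidual\<close>

abbreviation evaluation :: "'a::real_normed_vector \<Rightarrow> ('a \<Rightarrow>\<^sub>L real) \<Rightarrow> real" where
  "evaluation x \<equiv> \<lambda>g. blinfun_apply g x"

text \<open>Every weakly open set is the preimage of an open set under the evaluation map, so open covers
  of \<open>S\<close> come from open covers of its image.\<close>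

lemma compactin_weak_topologyI:
  assumes "compact (evaluation ` S)"
  shows "compactin weak_topology S"
  unfolding compactin_def
proof (intro conjI allI impI)
  show "S \<subseteq> topspace weak_topology"
    by (simp add: weak_topology_def topspace_pullback_topology)
next
  fix \<U> :: "'a set set"
  assume U: "(\<forall>U\<in>\<U>. openin weak_topology U) \<and> S \<subseteq> \<Union>\<U>"
  then have "\<forall>U\<in>\<U>. \<exists>V. open V \<and> U = evaluation -` V"
    by (simp add: weak_topology_def openin_pullback_topology)
  then obtain V where V: "\<And>U. U \<in> \<U> \<Longrightarrow> open (V U)" "\<And>U x. U \<in> \<U> \<Longrightarrow> x \<in> U \<longleftrightarrow> evaluation x \<in> V U"
    by (metis vimage_eq)
  have "evaluation ` S \<subseteq> (\<Union>U\<in>\<U>. V U)"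
  proof (rule image_subsetI)
    fix x assume "x \<in> S"
    then obtain U where "U \<in> \<U>" "x \<in> U" using U by blast
    then show "evaluation x \<in> (\<Union>U\<in>\<U>. V U)" using V(2) by blast
  qed
  then obtain \<F> where "\<F> \<subseteq> \<U>" "finite \<F>" and F: "evaluation ` S \<subseteq> (\<Union>U\<in>\<F>. V U)"
    using compactE_image[OF assms, of \<U> V] V(1) by metis
  moreover have "S \<subseteq> \<Union>\<F>"
  proof
    fix x assume "x \<in> S"
    then obtain U where "U \<in> \<F>" "evaluation x \<in> V U"
      using F by blast
    then show "x \<in> \<Union>\<F>" using V(2) \<open>\<F> \<subseteq> \<U>\<close> by (intro UnionI[of U]) auto
  qed
  ultimately show "\<exists>\<F>. finite \<F> \<and> \<F> \<subseteq> \<U> \<and> S \<subseteq> \<Union>\<F>" by blast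
qed

text \<open>Here \<open>'a\<close> is to be thought of as a dual space, so that \<open>\<phi>\<close> runs over its dual, the bidual. The
  elements are bare functions instead of bounded linear maps, because the topology in
  question is that of pointwise convergence.\<close>

definition positive_bidual_ball :: "(nat \<Rightarrow> 'a::real_normed_vector) \<Rightarrow> ('a \<Rightarrow> real) set" where
  "positive_bidual_ball f =
     {\<phi>. linear \<phi> \<and> (\<forall>g. \<bar>\<phi> g\<bar> \<le> norm g) \<and> (\<forall>n. 0 \<le> \<phi> (f n))}"

text \<open>This is the Banach-Alaoglu argument: the norm bound confines \<open>\<phi>\<close> to a product of compact
  intervals, and linearity and positivity only involve finitely many coordinates at a time, so they
  are closed conditions.\<close>

lemma compact_positive_bidual_ball: "compact (positive_bidual_ball f)"
proof -
  let ?box = "PiE UNIV (\<lambda>g. {- norm g..norm g}) :: ('a \<Rightarrow> real) set"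
  have "compactin (product_topology (\<lambda>_. euclidean) UNIV) ?box"
    by (simp add: compactin_PiE)
  then have "compact ?box"
    by (simp add: euclidean_product_topology)
  moreover have "closed {\<phi> :: 'a \<Rightarrow> real. (\<forall>x y. \<phi> (x + y) = \<phi> x + \<phi> y)
      \<and> (\<forall>c x. \<phi> (c *\<^sub>R x) = c *\<^sub>R \<phi> x) \<and> (\<forall>n. 0 \<le> \<phi> (f n))}" (is "closed ?L")
    by (intro closed_Collect_conj closed_Collect_all closed_Collect_eq closed_Collect_le
        continuous_on_add continuous_on_scaleR continuous_on_const continuous_on_product_coordinates)
  moreover have "positive_bidual_ball f = ?box \<inter> ?L"
    by (auto simp: positive_bidual_ball_def linear_iff abs_le_iff PiE_UNIV_domain Pi_iff
        minus_le_iff)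
  ultimately show ?thesis by (simp add: compact_Int_closed)
qed

section \<open>The positive cone of a shrinking basis\<close>

lemma basis_coeff_eq:
  assumes "schauder_basis b" "(\<lambda>k. a k *\<^sub>R b k) sums x"
  shows "basis_coeff b n x = a n"
proof -
  have "(THE a. (\<lambda>k. a k *\<^sub>R b k) sums x) = a"
    using assms by (intro the1_equality) (auto simp: schauder_basis_def)
  then show ?thesis by (simp add: basis_coeff_def)
qed

lemma basis_coeff_basis:
  assumes "schauder_basis b"
  shows "basis_coeff b n (b i) = (if n = i then 1 else 0)"
proof -
  have "(\<lambda>k. (if k = i then 1 else 0) *\<^sub>R b k) sums b i"
    using sums_single[of i b] by (simp add: if_distrib[of "\<lambda>c. c *\<^sub>R _"] cong: if_cong)
  then show ?thesis by (rule basis_coeff_eq[OF assms])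
qed

text \<open>The expansion of \<open>g\<close> in the basis \<open>f\<close> of the dual has the coefficients \<open>g (b n)\<close>, as one sees by
  evaluating it at \<open>b n\<close>. Applying \<open>\<phi>\<close> to the expansion exchanges the roles of the factors in each
  term. Thus \<open>\<phi>\<close> is the weak limit of the partial sums of \<open>\<Sum>n. \<phi> (f n) *\<^sub>R b n\<close>.\<close>

lemma bidual_apply_sums:
  assumes b: "schauder_basis b" and f: "\<And>n x. blinfun_apply (f n) x = basis_coeff b n x"
    and "schauder_basis f" and \<phi>: "bounded_linear \<phi>"
  shows "(\<lambda>n. blinfun_apply g (\<phi> (f n) *\<^sub>R b n)) sums \<phi> g"
proof -
  obtain c where c: "(\<lambda>n. c n *\<^sub>R f n) sums g"
    using assms(3) unfolding schauder_basis_def by blast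
  have "blinfun_apply g (b i) = c i" for i
  proof -
    have "(\<lambda>n. blinfun_apply (c n *\<^sub>R f n) (b i)) sums blinfun_apply g (b i)"
      by (rule bounded_linear.sums[OF blinfun.bounded_linear_left c])
    moreover have "(\<lambda>n. blinfun_apply (c n *\<^sub>R f n) (b i)) = (\<lambda>n. if n = i then c n else 0)"
      by (auto simp: blinfun.scaleR_left f basis_coeff_basis[OF b])
    ultimately show ?thesis using sums_single[of i c] by (simp add: sums_unique2)
  qed
  moreover have "(\<lambda>n. \<phi> (c n *\<^sub>R f n)) sums \<phi> g"
    by (rule bounded_linear.sums[OF \<phi> c])
  ultimately show ?thesis
    by (simp add: blinfun.scaleR_right linear_scale[OF bounded_linear.linear[OF \<phi>]] mult.commute)
qed

text \<open>Only the inclusion from right to left is substantial: it says that an element of the bidual ball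
  with nonnegative coefficients is evaluation at a point of the space. Bounded completeness on the
  cone provides that point.\<close>

lemma evaluation_image_cone_ball:
  assumes b: "schauder_basis b" and f: "\<And>n x. blinfun_apply (f n) x = basis_coeff b n x"
    and "schauder_basis f" and bc: "boundedly_complete_on_cone b"
  shows "evaluation ` (positive_cone b \<inter> cball 0 1) = positive_bidual_ball f"
proof (intro subset_antisym subsetI)
  fix \<phi> assume "\<phi> \<in> evaluation ` (positive_cone b \<inter> cball 0 1)"
  then obtain x where \<phi>: "\<phi> = evaluation x" and x: "norm x \<le> 1" and "x \<in> positive_cone b"
    by auto
  then obtain a where a: "\<And>n. 0 \<le> a n" "(\<lambda>n. a n *\<^sub>R b n) sums x"
    unfolding positive_cone_def by blast
  have "\<bar>blinfun_apply g x\<bar> \<le> norm g" for g :: "'a \<Rightarrow>\<^sub>L real"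
  proof -
    have "\<bar>blinfun_apply g x\<bar> \<le> norm g * norm x" using norm_blinfun[of g x] by simp
    also have "\<dots> \<le> norm g" using x by (simp add: mult_left_le)
    finally show ?thesis .
  qed
  then show "\<phi> \<in> positive_bidual_ball f"
    using a basis_coeff_eq[OF b a(2)]
    by (simp add: positive_bidual_ball_def \<phi> f bounded_linear.linear blinfun.bounded_linear_left)
next
  fix \<phi> assume "\<phi> \<in> positive_bidual_ball f"
  then have lin: "linear \<phi>" and le: "\<And>g. \<bar>\<phi> g\<bar> \<le> norm g" and pos: "\<And>n. 0 \<le> \<phi> (f n)"
    by (auto simp: positive_bidual_ball_def)
  have bl: "bounded_linear \<phi>"
    using lin le by (intro bounded_linear_intro[where K = 1]) (auto simp: linear_add linear_scale)
  \<comment> \<open>The partial sums of the series whose sum will represent \<open>\<phi>\<close>.\<close>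
  define y where "y n = (\<Sum>i\<le>n. \<phi> (f i) *\<^sub>R b i)" for n
  have "bounded (range y)"
  proof (rule weakly_bounded_imp_bounded)
    fix g :: "'a \<Rightarrow>\<^sub>L real"
    have "(\<lambda>n. blinfun_apply g (y n)) \<longlonglongrightarrow> \<phi> g"
      using bidual_apply_sums[OF b f assms(3) bl, of g]
      by (simp add: sums_def_le y_def blinfun.sum_right)
    then show "bounded (blinfun_apply g ` range y)"
      using convergent_imp_bounded by (force simp: image_image)
  qed
  then have "bdd_above (range (\<lambda>n. norm (\<Sum>i\<le>n. \<phi> (f i) *\<^sub>R b i)))"
    by (auto simp: bounded_iff y_def bdd_above_def)
  then have "summable (\<lambda>n. \<phi> (f n) *\<^sub>R b n)"
    using bc[unfolded boundedly_complete_on_cone_def, rule_format, of "\<lambda>n. \<phi> (f n)"] pos by simp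
  then obtain x where x: "(\<lambda>n. \<phi> (f n) *\<^sub>R b n) sums x" by (auto simp: summable_def)
  have \<phi>: "\<phi> g = blinfun_apply g x" for g
    by (rule sums_unique2[OF bidual_apply_sums[OF b f assms(3) bl]
          bounded_linear.sums[OF blinfun.bounded_linear_right x]])
  obtain g :: "'a \<Rightarrow>\<^sub>L real" where "norm g \<le> 1" "blinfun_apply g x = norm x"
    by (rule exists_norming_functional)
  then have "norm x \<le> 1" using le[of g] by (simp add: \<phi>)
  moreover have "x \<in> positive_cone b"
    unfolding positive_cone_def by (intro CollectI exI[of _ "\<lambda>n. \<phi> (f n)"] conjI allI pos x)
  ultimately show "\<phi> \<in> evaluation ` (positive_cone b \<inter> cball 0 1)"
    by (intro image_eqI[of _ _ x] ext \<phi>) auto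
qed

theorem theorem6p3:
  fixes b :: "nat \<Rightarrow> 'a::banach"
  assumes "schauder_basis b"
    and "shrinking_basis b"
    and "boundedly_complete_on_cone b"
  shows "reflexive_cone (positive_cone b)"
proof -
  obtain f where "\<And>n x. blinfun_apply (f n) x = basis_coeff b n x" "schauder_basis f"
    using assms(2) unfolding shrinking_basis_def by blast
  then have "evaluation ` (positive_cone b \<inter> cball 0 1) = positive_bidual_ball f"
    using assms by (intro evaluation_image_cone_ball)
  then show ?thesis
    unfolding reflexive_cone_def
    by (intro compactin_weak_topologyI) (simp add: compact_positive_bidual_ball)
qed

end
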